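(* For any $h\in\mathcal{K}(\epsilon)$ and $d\in\mathbb{H}$, consider the optimization problem $$\gamma^\ast=\operatorname*{argmin}_{\gamma\in[0,1]}\ \eta(h+\gamma d).$$ Then exactly one of the following assertions holds. (1) If $\langle x,\phi(d)\rangle\le\eta(h)\langle\phi(h),\phi(d)\rangle$, then $\gamma^\ast=0$. (2) If $h+d\in\mathcal{K}(\epsilon)$ and $\langle x,\phi(d)\rangle\ge\eta(h+d)\langle\phi(h+d),\phi(d)\rangle$, then $\gamma^\ast=1$. (3) Otherwise, $\gamma^\ast\in(0,1)$ is the root of the quadratic equation $a\gamma^2+2b\gamma+c=0$ that also satisfies $$\frac{\langle x,\phi(h+\gamma^\ast d)\rangle}{\|x\|^2-\epsilon^2}\le\frac{\langle\phi(h+\gamma^\ast d),\phi(d)\rangle}{\langle x,\phi(d)\rangle},$$ where $$a=\|\phi(d)\|^2\bigl(e(d)-\epsilon^2\bigr),\qquad b=(\|x\|^2-\epsilon^2)\langle\phi(h),\phi(d)\rangle-\langle x,\phi(h)\rangle\langle x,\phi(d)\rangle,$$ $$c=\frac{(\|x\|^2-\epsilon^2)\langle\phi(h),\phi(d)\rangle^2}{\|\phi(d)\|^2}-\frac{2\langle x,\phi(d)\rangle\langle x,\phi(h)\rangle\langle\phi(h),\phi(d)\rangle}{\|\phi(d)\|^2}+\frac{\|\phi(h)\|^2\langle x,\phi(d)\rangle^2}{\|\phi(d)\|^2}.$$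
   Context: $\mathbb{H}$ is a finite-dimensional real Hilbert space; $\mathbb{R}^n$ carries an inner product $\langle\cdot,\cdot\rangle$ with associated norm $\|\cdot\|$; $\phi:\mathbb{H}\to\mathbb{R}^n$ is linear; $x\in\mathbb{R}^n$, $\epsilon>0$. Standing assumption: $\|x\|>\epsilon>0$ and there exists $f\in\mathbb{H}$ with $\|x-\phi(f)\|<\epsilon$. Definitions. For $h\in\mathbb{H}$, $e(h):=\min_{\theta\in\mathbb{R}}\|x-\theta\phi(h)\|^2$, i.e. $e(h)=\|x\|^2$ if $\phi(h)=0$ and $e(h)=\|x\|^2-|\langle x,\phi(h)\rangle|^2/\|\phi(h)\|^2$ otherwise. $\mathcal{K}(\epsilon):=\{h\in\mathbb{H}:\langle x,\phi(h)\rangle>0,\ e(h)\le\epsilon^2\}$. The function $\eta:\mathcal{K}(\epsilon)\to[0,\infty)$ is $$\eta(h):=\frac{\|x\|^2-\epsilon^2}{\langle x,\phi(h)\rangle+\|\phi(h)\|\sqrt{\epsilon^2-e(h)}},$$ and $\eta(h)=+\infty$ by convention for $h\notin\mathcal{K}(\epsilon)$, so that the minimization is effectively over those $\gamma\in[0,1]$ with $h+\gamma d\in\mathcal{K}(\epsilon)$.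
   Formalization: If φ(d)=0, (1),(2) both hold and all of [0,1] minimizes, as stated. If e(h)=ε², φ(d)=tφ(h): (1) is not claimed for t>0 (γ*=1), nor (2) for t<0 (γ*=0 when h+d∈K). In (3) the inequality is required only if ⟨x,φ(d)⟩≠0. *)

theory Defs
  imports "HOL-Analysis.Analysis"
begin

text \<open>
  Two types of class \<open>euclidean_space\<close> model the finite-dimensional real Hilbert space
  (\<open>'h\<close>) and \<open>R^n\<close> with an arbitrary inner product (\<open>'v\<close>): the class fixes an inner product and
  the norm induced by it, and nothing else is used about it.
\<close>

definition err :: "'v::euclidean_space \<Rightarrow> ('h::euclidean_space \<Rightarrow> 'v) \<Rightarrow> 'h \<Rightarrow> real" where
  "err x \<phi> h = (INF \<theta>::real. (norm (x - \<theta> *\<^sub>R \<phi> h))\<^sup>2)"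

definition feas :: "'v::euclidean_space \<Rightarrow> ('h::euclidean_space \<Rightarrow> 'v) \<Rightarrow> real \<Rightarrow> 'h set" where
  "feas x \<phi> \<epsilon> = {h. x \<bullet> \<phi> h > 0 \<and> err x \<phi> h \<le> \<epsilon>\<^sup>2}"

text \<open>
  \<open>eta\<close> is meaningful on \<open>feas x \<phi> \<epsilon>\<close> only; \<open>eta_ext\<close> is its extension by infinity, which is
  the function being minimized.
\<close>

definition eta :: "'v::euclidean_space \<Rightarrow> ('h::euclidean_space \<Rightarrow> 'v) \<Rightarrow> real \<Rightarrow> 'h \<Rightarrow> real" where
  "eta x \<phi> \<epsilon> h =
     ((norm x)\<^sup>2 - \<epsilon>\<^sup>2) / (x \<bullet> \<phi> h + norm (\<phi> h) * sqrt (\<epsilon>\<^sup>2 - err x \<phi> h))"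

definition eta_ext :: "'v::euclidean_space \<Rightarrow> ('h::euclidean_space \<Rightarrow> 'v) \<Rightarrow> real \<Rightarrow> 'h \<Rightarrow> ereal" where
  "eta_ext x \<phi> \<epsilon> h = (if h \<in> feas x \<phi> \<epsilon> then ereal (eta x \<phi> \<epsilon> h) else \<infinity>)"

definition argmin_set ::
  "'v::euclidean_space \<Rightarrow> ('h::euclidean_space \<Rightarrow> 'v) \<Rightarrow> real \<Rightarrow> 'h \<Rightarrow> 'h \<Rightarrow> real set" where
  "argmin_set x \<phi> \<epsilon> h d =
     {\<gamma>. is_arg_min (\<lambda>\<gamma>. eta_ext x \<phi> \<epsilon> (h + \<gamma> *\<^sub>R d)) (\<lambda>\<gamma>. \<gamma> \<in> {0..1}) \<gamma>}"

definition cond_left ::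
  "'v::euclidean_space \<Rightarrow> ('h::euclidean_space \<Rightarrow> 'v) \<Rightarrow> real \<Rightarrow> 'h \<Rightarrow> 'h \<Rightarrow> bool" where
  "cond_left x \<phi> \<epsilon> h d \<longleftrightarrow> x \<bullet> \<phi> d \<le> eta x \<phi> \<epsilon> h * (\<phi> h \<bullet> \<phi> d)"

definition cond_right ::
  "'v::euclidean_space \<Rightarrow> ('h::euclidean_space \<Rightarrow> 'v) \<Rightarrow> real \<Rightarrow> 'h \<Rightarrow> 'h \<Rightarrow> bool" where
  "cond_right x \<phi> \<epsilon> h d \<longleftrightarrow>
     h + d \<in> feas x \<phi> \<epsilon> \<and> x \<bullet> \<phi> d \<ge> eta x \<phi> \<epsilon> (h + d) * (\<phi> (h + d) \<bullet> \<phi> d)"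

definition coeff_a :: "'v::euclidean_space \<Rightarrow> ('h::euclidean_space \<Rightarrow> 'v) \<Rightarrow> real \<Rightarrow> 'h \<Rightarrow> real" where
  "coeff_a x \<phi> \<epsilon> d = (norm (\<phi> d))\<^sup>2 * (err x \<phi> d - \<epsilon>\<^sup>2)"

definition coeff_b ::
  "'v::euclidean_space \<Rightarrow> ('h::euclidean_space \<Rightarrow> 'v) \<Rightarrow> real \<Rightarrow> 'h \<Rightarrow> 'h \<Rightarrow> real" where
  "coeff_b x \<phi> \<epsilon> h d =
     ((norm x)\<^sup>2 - \<epsilon>\<^sup>2) * (\<phi> h \<bullet> \<phi> d) - (x \<bullet> \<phi> h) * (x \<bullet> \<phi> d)"

definition coeff_c ::
  "'v::euclidean_space \<Rightarrow> ('h::euclidean_space \<Rightarrow> 'v) \<Rightarrow> real \<Rightarrow> 'h \<Rightarrow> 'h \<Rightarrow> real" where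
  "coeff_c x \<phi> \<epsilon> h d =
     ((norm x)\<^sup>2 - \<epsilon>\<^sup>2) * (\<phi> h \<bullet> \<phi> d)\<^sup>2 / (norm (\<phi> d))\<^sup>2
     - 2 * (x \<bullet> \<phi> d) * (x \<bullet> \<phi> h) * (\<phi> h \<bullet> \<phi> d) / (norm (\<phi> d))\<^sup>2
     + (norm (\<phi> h))\<^sup>2 * (x \<bullet> \<phi> d)\<^sup>2 / (norm (\<phi> d))\<^sup>2"

text \<open>
  If \<open>x \<bullet> \<phi> d = 0\<close>, the right-hand side of the selecting inequality is undefined (and the two roots
  of the quadratic coincide), so the inequality is required only for \<open>x \<bullet> \<phi> d \<noteq> 0\<close>; with the
  convention \<open>z / 0 = 0\<close> it would otherwise wrongly reject the root.
\<close>

definition selected_root ::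
  "'v::euclidean_space \<Rightarrow> ('h::euclidean_space \<Rightarrow> 'v) \<Rightarrow> real \<Rightarrow> 'h \<Rightarrow> 'h \<Rightarrow> real \<Rightarrow> bool" where
  "selected_root x \<phi> \<epsilon> h d \<gamma> \<longleftrightarrow>
     coeff_a x \<phi> \<epsilon> d * \<gamma>\<^sup>2 + 2 * coeff_b x \<phi> \<epsilon> h d * \<gamma> + coeff_c x \<phi> \<epsilon> h d = 0 \<and>
     (x \<bullet> \<phi> d \<noteq> 0 \<longrightarrow>
        (x \<bullet> \<phi> (h + \<gamma> *\<^sub>R d)) / ((norm x)\<^sup>2 - \<epsilon>\<^sup>2)
          \<le> (\<phi> (h + \<gamma> *\<^sub>R d) \<bullet> \<phi> d) / (x \<bullet> \<phi> d))"

text \<open>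
  The three alternatives for a minimizer \<open>\<gamma>\<close>: each one joins the case distinction with the
  corresponding claim about \<open>\<gamma>\<close>.  In the last one \<open>\<gamma>\<close> is the only real number satisfying
  \<open>selected_root\<close>, not just the only one in the unit interval.
\<close>

definition alt_left ::
  "'v::euclidean_space \<Rightarrow> ('h::euclidean_space \<Rightarrow> 'v) \<Rightarrow> real \<Rightarrow> 'h \<Rightarrow> 'h \<Rightarrow> real \<Rightarrow> bool" where
  "alt_left x \<phi> \<epsilon> h d \<gamma> \<longleftrightarrow> cond_left x \<phi> \<epsilon> h d \<and> \<gamma> = 0"

definition alt_right ::
  "'v::euclidean_space \<Rightarrow> ('h::euclidean_space \<Rightarrow> 'v) \<Rightarrow> real \<Rightarrow> 'h \<Rightarrow> 'h \<Rightarrow> real \<Rightarrow> bool" where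
  "alt_right x \<phi> \<epsilon> h d \<gamma> \<longleftrightarrow> cond_right x \<phi> \<epsilon> h d \<and> \<gamma> = 1"

definition alt_interior ::
  "'v::euclidean_space \<Rightarrow> ('h::euclidean_space \<Rightarrow> 'v) \<Rightarrow> real \<Rightarrow> 'h \<Rightarrow> 'h \<Rightarrow> real \<Rightarrow> bool" where
  "alt_interior x \<phi> \<epsilon> h d \<gamma> \<longleftrightarrow>
     \<not> cond_left x \<phi> \<epsilon> h d \<and> \<not> cond_right x \<phi> \<epsilon> h d \<and> \<gamma> \<in> {0<..<1} \<and>
     selected_root x \<phi> \<epsilon> h d \<gamma> \<and> (\<forall>\<gamma>'. selected_root x \<phi> \<epsilon> h d \<gamma>' \<longrightarrow> \<gamma>' = \<gamma>)"

text \<open>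
  Degenerate directions: \<open>\<phi> h\<close> lies on the boundary of the cone generated by the ball of radius
  \<open>\<epsilon>\<close> around \<open>x\<close>, and \<open>h + \<gamma> *\<^sub>R d\<close> moves \<open>\<phi> h\<close> along its own ray.  Then
  \<open>cond_left\<close> holds with equality and, as long as \<open>h + d\<close> is feasible, so does \<open>cond_right\<close>; the
  minimizer is \<open>1\<close> when moving outward (\<open>t > 0\<close>) and \<open>0\<close> when moving inward (\<open>t < 0\<close>).
\<close>

definition outward_ray ::
  "'v::euclidean_space \<Rightarrow> ('h::euclidean_space \<Rightarrow> 'v) \<Rightarrow> real \<Rightarrow> 'h \<Rightarrow> 'h \<Rightarrow> bool" where
  "outward_ray x \<phi> \<epsilon> h d \<longleftrightarrow> err x \<phi> h = \<epsilon>\<^sup>2 \<and> (\<exists>t>0. \<phi> d = t *\<^sub>R \<phi> h)"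

definition inward_ray ::
  "'v::euclidean_space \<Rightarrow> ('h::euclidean_space \<Rightarrow> 'v) \<Rightarrow> real \<Rightarrow> 'h \<Rightarrow> 'h \<Rightarrow> bool" where
  "inward_ray x \<phi> \<epsilon> h d \<longleftrightarrow> err x \<phi> h = \<epsilon>\<^sup>2 \<and> (\<exists>t<0. \<phi> d = t *\<^sub>R \<phi> h)"

lemma err_attained: "\<exists>\<theta>::real. is_arg_min (\<lambda>\<theta>. (norm (x - \<theta> *\<^sub>R \<phi> h))\<^sup>2) (\<lambda>_. True) \<theta>
    \<and> err x \<phi> h = (norm (x - \<theta> *\<^sub>R \<phi> h))\<^sup>2"
  and err_eq: "err x \<phi> h =
    (if \<phi> h = 0 then (norm x)\<^sup>2 else (norm x)\<^sup>2 - \<bar>x \<bullet> \<phi> h\<bar>\<^sup>2 / (norm (\<phi> h))\<^sup>2)"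
proof -
  define t where "t = (x \<bullet> \<phi> h) / (norm (\<phi> h))\<^sup>2"
  have expand: "(norm (x - \<theta> *\<^sub>R \<phi> h))\<^sup>2
      = (norm x)\<^sup>2 - 2 * \<theta> * (x \<bullet> \<phi> h) + \<theta>\<^sup>2 * (norm (\<phi> h))\<^sup>2" for \<theta> :: real
    unfolding power2_norm_eq_inner
    by (simp add: inner_diff inner_commute power2_eq_square algebra_simps)
  have val: "(norm (x - t *\<^sub>R \<phi> h))\<^sup>2 =
      (if \<phi> h = 0 then (norm x)\<^sup>2 else (norm x)\<^sup>2 - \<bar>x \<bullet> \<phi> h\<bar>\<^sup>2 / (norm (\<phi> h))\<^sup>2)"
    unfolding expand t_def by (simp add: power2_eq_square)
  have diff: "(norm (x - \<theta> *\<^sub>R \<phi> h))\<^sup>2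
      = (norm (x - t *\<^sub>R \<phi> h))\<^sup>2 + (\<theta> - t)\<^sup>2 * (norm (\<phi> h))\<^sup>2" for \<theta> :: real
  proof (cases "\<phi> h = 0")
    case False
    then have "x \<bullet> \<phi> h = t * (norm (\<phi> h))\<^sup>2" by (simp add: t_def)
    then show ?thesis
      unfolding expand by (simp add: power2_eq_square algebra_simps)
  qed simp
  have le: "(norm (x - t *\<^sub>R \<phi> h))\<^sup>2 \<le> (norm (x - \<theta> *\<^sub>R \<phi> h))\<^sup>2" for \<theta> :: real
    by (subst diff[of \<theta>]) simp
  have eq: "err x \<phi> h = (norm (x - t *\<^sub>R \<phi> h))\<^sup>2"
    unfolding err_def by (rule cInf_eq_minimum) (use le in auto)
  show "err x \<phi> h =
    (if \<phi> h = 0 then (norm x)\<^sup>2 else (norm x)\<^sup>2 - \<bar>x \<bullet> \<phi> h\<bar>\<^sup>2 / (norm (\<phi> h))\<^sup>2)"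
    using eq val by simp
  show "\<exists>\<theta>::real. is_arg_min (\<lambda>\<theta>. (norm (x - \<theta> *\<^sub>R \<phi> h))\<^sup>2) (\<lambda>_. True) \<theta>
    \<and> err x \<phi> h = (norm (x - \<theta> *\<^sub>R \<phi> h))\<^sup>2"
    using eq le by (intro exI[of _ t]) (auto simp: is_arg_min_def not_less)
qed

end

theory Submission
  imports Defs
begin

text \<open>
  For \<open>y = \<phi> h\<close> in the cone over the ball of radius \<open>\<epsilon>\<close> around \<open>x\<close>, \<open>\<eta> h\<close> is the least \<open>t > 0\<close>
  such that \<open>t *\<^sub>R y\<close> lies in the ball, i.e. the point \<open>\<eta> h *\<^sub>R y\<close> is where the ray through \<open>y\<close>
  enters the ball.  With the inner normal \<open>r = x - \<eta> h *\<^sub>R y\<close> at that point, strict convexity of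
  the ball shows that moving from \<open>y\<close> within the cone in a direction \<open>w\<close> with \<open>r \<bullet> w \<le> 0\<close> strictly
  increases \<open>\<eta>\<close> (unless one moves outward along a boundary ray of the cone), whereas \<open>r \<bullet> w > 0\<close>
  makes small steps admissible and profitable.  So the sign of \<open>r \<bullet> \<phi> d\<close> at the two end points
  decides between the three cases, and an interior minimizer is characterized by \<open>r \<bullet> \<phi> d = 0\<close>.
  Eliminating \<open>\<eta>\<close> from this equation and from \<open>norm r = \<epsilon>\<close> gives the quadratic equation; the
  selecting inequality says that \<open>\<eta>\<close> belongs to the entry point rather than to the exit point.
\<close>

section \<open>Where a ray enters a ball\<close>

lemma norm_diff_square: "(norm (a - b))\<^sup>2 = (norm a)\<^sup>2 - 2 * (a \<bullet> b) + (norm b)\<^sup>2"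
  for a b :: "'a::real_inner"
  unfolding power2_norm_eq_inner by (simp add: inner_diff inner_commute)

locale ball_cone =
  fixes x :: "'v::real_inner" and \<epsilon> :: real
  assumes eps_pos: "0 < \<epsilon>" and eps_less: "\<epsilon> < norm x"
begin

definition M :: real where "M = (norm x)\<^sup>2 - \<epsilon>\<^sup>2"

text \<open>A quarter of the discriminant of the polynomial
  \<open>M - 2 * t * (x \<bullet> y) + t\<^sup>2 * (y \<bullet> y)\<close> in \<open>t\<close>,
  whose value is the excess of the squared distance from \<open>x\<close> to
  \<open>t *\<^sub>R y\<close> over \<open>\<epsilon>\<^sup>2\<close>. For nonzero \<open>y\<close>
  it is nonnegative iff the line spanned by \<open>y\<close> meets the ball.\<close>

definition disc :: "'v \<Rightarrow> real" where "disc y = (x \<bullet> y)\<^sup>2 - M * (y \<bullet> y)"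

definition cone :: "'v set" where "cone = {y. 0 < x \<bullet> y \<and> 0 \<le> disc y}"

text \<open>The smaller root of that polynomial, written with the conjugate in the denominator: this
  is the shape of \<open>eta\<close>, and the denominator is positive on all of
  \<open>cone\<close>.\<close>

definition entry :: "'v \<Rightarrow> real" where "entry y = M / (x \<bullet> y + sqrt (disc y))"

definition inward :: "'v \<Rightarrow> 'v" where "inward y = x - entry y *\<^sub>R y"

lemma M_pos: "0 < M"
  using eps_pos eps_less by (simp add: M_def power_strict_mono)

lemma norm_diff_scaleR:
  "(norm (x - t *\<^sub>R y))\<^sup>2 = \<epsilon>\<^sup>2 + (M - 2 * t * (x \<bullet> y) + t\<^sup>2 * (y \<bullet> y))"
  unfolding power2_norm_eq_inner M_def
  by (simp add: inner_diff inner_commute power2_eq_square algebra_simps)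

lemma entry_pos: "0 < entry y" if "y \<in> cone"
  using that M_pos unfolding entry_def cone_def
  by (auto intro!: divide_pos_pos add_pos_nonneg)

text \<open>Factoring \<open>M * (y \<bullet> y) = (p - s) * (p + s)\<close> gives
  \<open>entry y * (y \<bullet> y) = p - s\<close>, and both claims follow. The nonnegative sign in
  the first one marks the entry point; at the exit point the inner product would be
  \<open>- s\<close>.\<close>

lemma inward_inner: "inward y \<bullet> y = sqrt (disc y)"
  and entry_root: "M - 2 * entry y * (x \<bullet> y) + (entry y)\<^sup>2 * (y \<bullet> y) = 0"
  if "y \<in> cone"
proof -
  define p where "p = x \<bullet> y"
  define s where "s = sqrt (disc y)"
  have s2: "M * (y \<bullet> y) = (p - s) * (p + s)"
    using that by (simp add: s_def p_def cone_def disc_def power2_eq_square algebra_simps)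
  have ps: "0 < p + s"
    using that by (auto simp: s_def p_def cone_def intro!: add_pos_nonneg)
  have e: "entry y = M / (p + s)"
    by (simp add: entry_def p_def s_def)
  have "entry y * (y \<bullet> y) = p - s"
    using ps s2 by (simp add: e)
  then show 1: "inward y \<bullet> y = sqrt (disc y)"
    by (simp add: inward_def inner_diff_left p_def s_def)
  have "entry y * (p + s) = M"
    using ps by (simp add: e)
  moreover have "(entry y)\<^sup>2 * (y \<bullet> y) = entry y * (p - s)"
    using \<open>entry y * (y \<bullet> y) = p - s\<close> by (simp add: power2_eq_square)
  ultimately show "M - 2 * entry y * (x \<bullet> y) + (entry y)\<^sup>2 * (y \<bullet> y) = 0"
    unfolding p_def[symmetric] by (simp add: algebra_simps)
qed

lemma norm_inward: "norm (inward y) = \<epsilon>" if "y \<in> cone"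
proof -
  have "(norm (inward y))\<^sup>2 = \<epsilon>\<^sup>2"
    using entry_root[OF that] unfolding inward_def norm_diff_scaleR by simp
  then show ?thesis
    using eps_pos by (simp add: power2_eq_iff_nonneg)
qed

lemma cone_nonzero: "y \<noteq> 0" if "y \<in> cone"
  using that by (auto simp: cone_def)

text \<open>At a root \<open>t\<close>, \<open>disc y\<close> is the square of
  \<open>x \<bullet> y - t * (y \<bullet> y)\<close>. The hypothesis \<open>near\<close> fixes the
  sign of its square root, so \<open>t\<close> is the smaller root.\<close>

lemma entry_eqI:
  assumes t: "0 < t" and root: "M - 2 * t * (x \<bullet> y) + t\<^sup>2 * (y \<bullet> y) = 0"
    and near: "0 \<le> (x - t *\<^sub>R y) \<bullet> y"
  shows "y \<in> cone" "entry y = t"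
proof -
  have "M + t\<^sup>2 * (y \<bullet> y) > 0"
    using M_pos by (intro add_pos_nonneg) auto
  then have "0 < 2 * t * (x \<bullet> y)"
    using root by linarith
  then have p: "0 < x \<bullet> y"
    using t by (simp add: zero_less_mult_iff)
  have M: "M = 2 * t * (x \<bullet> y) - t\<^sup>2 * (y \<bullet> y)"
    using root by simp
  have D: "disc y = (x \<bullet> y - t * (y \<bullet> y))\<^sup>2"
    unfolding disc_def M by (simp add: power2_eq_square algebra_simps)
  then show "y \<in> cone"
    using p by (simp add: cone_def)
  have n: "0 \<le> x \<bullet> y - t * (y \<bullet> y)"
    using near by (simp add: inner_diff_left)
  then have "sqrt (disc y) = x \<bullet> y - t * (y \<bullet> y)"
    by (simp add: D)
  moreover have "t * (x \<bullet> y + (x \<bullet> y - t * (y \<bullet> y))) = M"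
    by (simp add: M power2_eq_square algebra_simps)
  moreover have "0 < x \<bullet> y + (x \<bullet> y - t * (y \<bullet> y))"
    using p n by linarith
  ultimately show "entry y = t"
    unfolding entry_def by (simp add: divide_eq_eq)
qed

text \<open>Minimality of \<open>entry\<close> by completing the square:
  \<open>t\<^sup>2 * disc y\<close> equals \<open>(t * (x \<bullet> y) - M)\<^sup>2\<close> minus
  \<open>M\<close> times the polynomial, which is nonpositive here. Taking roots yields
  \<open>M \<le> t * (x \<bullet> y + sqrt (disc y))\<close>. Strictness holds because the distance
  at \<open>entry y\<close> is exactly \<epsilon>.\<close>

lemma entry_le:
  assumes t: "0 < t" and le: "norm (x - t *\<^sub>R y) \<le> \<epsilon>"
  shows "y \<in> cone" "entry y \<le> t" "norm (x - t *\<^sub>R y) < \<epsilon> \<Longrightarrow> entry y < t"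
proof -
  have quad: "M - 2 * t * (x \<bullet> y) + t\<^sup>2 * (y \<bullet> y) \<le> 0"
    using power_mono[OF le, of 2] by (simp add: norm_diff_scaleR)
  have "M + t\<^sup>2 * (y \<bullet> y) > 0"
    using M_pos by (intro add_pos_nonneg) auto
  then have "0 < 2 * t * (x \<bullet> y)"
    using quad by linarith
  then have p: "0 < x \<bullet> y"
    using t by (simp add: zero_less_mult_iff)
  have "t\<^sup>2 * disc y = (t * (x \<bullet> y) - M)\<^sup>2 - M * (M - 2 * t * (x \<bullet> y) + t\<^sup>2 * (y \<bullet> y))"
    unfolding disc_def by (simp add: power2_eq_square algebra_simps)
  then have D: "(t * (x \<bullet> y) - M)\<^sup>2 \<le> t\<^sup>2 * disc y"
    using mult_left_mono[OF quad, of M] M_pos by simp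
  then have "0 \<le> t\<^sup>2 * disc y"
    using zero_le_power2 order_trans by blast
  then have "0 \<le> disc y"
    using t by (simp add: zero_le_mult_iff)
  then show c: "y \<in> cone"
    using p by (simp add: cone_def)
  have "\<bar>t * (x \<bullet> y) - M\<bar> \<le> t * sqrt (disc y)"
    using real_sqrt_le_mono[OF D] t by (simp add: real_sqrt_mult)
  then have "M \<le> t * (x \<bullet> y + sqrt (disc y))"
    by (simp add: algebra_simps)
  moreover have "0 < x \<bullet> y + sqrt (disc y)"
    using p \<open>0 \<le> disc y\<close> by (auto intro: add_pos_nonneg)
  ultimately show le': "entry y \<le> t"
    unfolding entry_def by (simp add: pos_divide_le_eq)
  show "entry y < t" if "norm (x - t *\<^sub>R y) < \<epsilon>"
    using that norm_inward[OF c] le' unfolding inward_def by (cases "entry y = t") auto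
qed

section \<open>Scaling along rays and strict comparison of entry parameters\<close>

lemma disc_scaleR: "disc (c *\<^sub>R y) = c\<^sup>2 * disc y"
  by (simp add: disc_def power2_eq_square algebra_simps)

lemma cone_scaleR: "c *\<^sub>R y \<in> cone \<longleftrightarrow> y \<in> cone" if "0 < c"
  using that by (simp add: cone_def disc_scaleR zero_less_mult_iff zero_le_mult_iff)

text \<open>Scaling \<open>y\<close> divides \<open>entry y\<close> by the same factor, so the entry
  point depends on the ray only.\<close>

lemma inward_scaleR: "inward (c *\<^sub>R y) = inward y" if "0 < c"
proof -
  have "sqrt (disc (c *\<^sub>R y)) = c * sqrt (disc y)"
    using that by (simp add: disc_scaleR real_sqrt_mult)
  then have "entry (c *\<^sub>R y) = M / (c * (x \<bullet> y + sqrt (disc y)))"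
    by (simp add: entry_def distrib_left)
  then have "c * entry (c *\<^sub>R y) = entry y"
    using that by (simp add: entry_def[of y])
  then show ?thesis
    by (simp add: inward_def mult.commute)
qed

text \<open>Expand the distance from \<open>x\<close> to \<open>b\<close> around the entry point,
  which lies on the sphere. The squared norm on the left carries strict convexity: a ball point
  other than the entry point lies strictly on the inner side of the tangent hyperplane.\<close>

lemma supporting_hyperplane:
  assumes y: "y \<in> cone" and b: "norm (x - b) \<le> \<epsilon>"
  shows "(norm (b - entry y *\<^sub>R y))\<^sup>2 \<le> 2 * (inward y \<bullet> (b - entry y *\<^sub>R y))"
proof -
  have "x - b = inward y - (b - entry y *\<^sub>R y)"
    by (simp add: inward_def)
  then have "(norm (x - b))\<^sup>2
      = (norm (inward y))\<^sup>2 - 2 * (inward y \<bullet> (b - entry y *\<^sub>R y)) + (norm (b - entry y *\<^sub>R y))\<^sup>2"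
    by (simp only: norm_diff_square)
  moreover have "(norm (x - b))\<^sup>2 \<le> \<epsilon>\<^sup>2"
    using b by (intro power_mono) auto
  ultimately show ?thesis
    by (simp add: norm_inward[OF y])
qed

text \<open>If the two entry points differ, that of \<open>z\<close> lies strictly inside the
  tangent hyperplane at that of \<open>y\<close>; together with \<open>le\<close> this makes
  \<open>(entry z - entry y) * sqrt (disc y)\<close> positive. If they coincide, \<open>z\<close> is
  a multiple of \<open>y\<close>, and a factor above 1 is compatible with \<open>le\<close> only
  when the ray is tangent to the ball.\<close>

lemma entry_less_cases:
  assumes y: "y \<in> cone" and z: "z \<in> cone" and "z \<noteq> y" and le: "inward y \<bullet> (z - y) \<le> 0"
  obtains "entry y < entry z" | k where "disc y = 0" "1 < k" "z = k *\<^sub>R y"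
proof (cases "entry z *\<^sub>R z = entry y *\<^sub>R y")
  case True
  define k where "k = entry y / entry z"
  have k: "z = k *\<^sub>R y"
    using arg_cong[OF True, of "\<lambda>w. (1 / entry z) *\<^sub>R w"] entry_pos[OF z] by (simp add: k_def)
  have "k \<noteq> 1"
    using \<open>z \<noteq> y\<close> k by auto
  show ?thesis
  proof (cases "1 < k")
    case True
    have "inward y \<bullet> (z - y) = (k - 1) * sqrt (disc y)"
      using inward_inner[OF y] by (simp add: k inner_diff_right algebra_simps)
    then have "sqrt (disc y) \<le> 0"
      using le True by (simp add: mult_le_0_iff)
    then have "disc y = 0"
      using y by (simp add: cone_def)
    then show ?thesis
      using that(2) True k by blast
  next
    case False
    with \<open>k \<noteq> 1\<close> have "entry y < entry z"
      using entry_pos[OF z] by (simp add: k_def)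
    then show ?thesis
      using that(1) by blast
  qed
next
  case False
  have "norm (x - entry z *\<^sub>R z) \<le> \<epsilon>"
    using norm_inward[OF z] by (simp add: inward_def)
  then have "(norm (entry z *\<^sub>R z - entry y *\<^sub>R y))\<^sup>2
      \<le> 2 * (inward y \<bullet> (entry z *\<^sub>R z - entry y *\<^sub>R y))"
    by (rule supporting_hyperplane[OF y])
  moreover have "0 < (norm (entry z *\<^sub>R z - entry y *\<^sub>R y))\<^sup>2"
    using False by simp
  ultimately have "0 < inward y \<bullet> (entry z *\<^sub>R z - entry y *\<^sub>R y)"
    by linarith
  then have "0 < entry z * (inward y \<bullet> z) - entry y * (inward y \<bullet> y)"
    by (simp add: inner_diff_right)
  also have "\<dots> \<le> entry z * (inward y \<bullet> y) - entry y * (inward y \<bullet> y)"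
    using le entry_pos[OF z] by (simp add: inner_diff_right)
  also have "\<dots> = (entry z - entry y) * sqrt (disc y)"
    by (simp add: inward_inner[OF y] left_diff_distrib)
  finally have "entry y < entry z"
    using y by (auto simp: zero_less_mult_iff cone_def)
  then show ?thesis
    using that(1) by blast
qed

text \<open>Keep \<open>t = entry y\<close> fixed and move \<open>y\<close>: for \<delta> below the
  stated bound the linear gain outweighs the quadratic term, so
  \<open>t *\<^sub>R (y + \<delta> *\<^sub>R v)\<close> is strictly inside the ball and
  \<open>entry_le\<close> applies.\<close>

lemma improving_direction:
  assumes y: "y \<in> cone" and pos: "0 < inward y \<bullet> v"
  obtains r where "0 < r" "\<And>\<delta>. 0 < \<delta> \<Longrightarrow> \<delta> < r \<Longrightarrow> y + \<delta> *\<^sub>R v \<in> cone \<and> entry (y + \<delta> *\<^sub>R v) < entry y"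
proof
  define t where "t = entry y"
  have t: "0 < t"
    using entry_pos[OF y] by (simp add: t_def)
  have v: "0 < v \<bullet> v"
    using pos by (cases "v = 0") auto
  show "0 < 2 * (inward y \<bullet> v) / (t * (v \<bullet> v))"
    using pos t v by simp
  fix \<delta> :: real
  assume \<delta>: "0 < \<delta>" "\<delta> < 2 * (inward y \<bullet> v) / (t * (v \<bullet> v))"
  have "x - t *\<^sub>R (y + \<delta> *\<^sub>R v) = inward y - (t * \<delta>) *\<^sub>R v"
    by (simp add: inward_def t_def scaleR_add_right)
  then have "(norm (x - t *\<^sub>R (y + \<delta> *\<^sub>R v)))\<^sup>2 = (norm (inward y - (t * \<delta>) *\<^sub>R v))\<^sup>2"
    by simp
  also have "\<dots> = (norm (inward y))\<^sup>2 - (t * \<delta>) * (2 * (inward y \<bullet> v) - \<delta> * (t * (v \<bullet> v)))"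
    unfolding norm_diff_square
    by (simp add: power_mult_distrib power2_norm_eq_inner[of v] power2_eq_square[of t]
        power2_eq_square[of \<delta>] algebra_simps)
  also have "\<dots> < \<epsilon>\<^sup>2"
    using \<delta> t v by (simp add: norm_inward[OF y] pos_less_divide_eq)
  finally have "norm (x - t *\<^sub>R (y + \<delta> *\<^sub>R v)) < \<epsilon>"
    using eps_pos by (simp add: power2_less_imp_less)
  with t show "y + \<delta> *\<^sub>R v \<in> cone \<and> entry (y + \<delta> *\<^sub>R v) < entry y"
    using entry_le[of t "y + \<delta> *\<^sub>R v"] by (simp add: t_def)
qed

section \<open>Minimizers of \<open>entry\<close> on a segment\<close>

lemma entry_minimizer_exists:
  assumes u: "u \<in> cone"
  obtains g where "g \<in> {0..1}" "u + g *\<^sub>R v \<in> cone"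
    "\<And>g'. g' \<in> {0..1} \<Longrightarrow> u + g' *\<^sub>R v \<in> cone \<Longrightarrow> entry (u + g *\<^sub>R v) \<le> entry (u + g' *\<^sub>R v)"
proof -
  \<comment> \<open>Minimizing \<open>t\<close> over pairs avoids continuity of \<open>entry\<close> and closedness of the feasible set.\<close>
  define C where "C = ({0..1} \<times> {0..entry u}) \<inter> {(g, t). norm (x - t *\<^sub>R (u + g *\<^sub>R v)) \<le> \<epsilon>}"
  have "closed {(g :: real, t :: real). norm (x - t *\<^sub>R (u + g *\<^sub>R v)) \<le> \<epsilon>}"
    unfolding case_prod_beta by (intro closed_Collect_le continuous_intros)
  then have "compact C"
    unfolding C_def by (intro compact_Int_closed compact_Times) auto
  moreover have "(0, entry u) \<in> C"
    using entry_pos[OF u] norm_inward[OF u] by (simp add: C_def inward_def)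
  ultimately obtain c where c: "c \<in> C" "\<forall>c'\<in>C. snd c \<le> snd c'"
    using continuous_attains_inf[of C snd] continuous_on_snd[OF continuous_on_id, of C] by blast
  obtain g t where gt: "c = (g, t)" by fastforce
  have g: "g \<in> {0..1}" and t: "0 \<le> t" and tu: "t \<le> entry u"
    and n: "norm (x - t *\<^sub>R (u + g *\<^sub>R v)) \<le> \<epsilon>"
    using c(1) by (auto simp: gt C_def)
  \<comment> \<open>For \<open>t = 0\<close> the point would be the origin, which lies outside the
    ball.\<close>
  have "t \<noteq> 0"
    using n eps_less by auto
  with t have t: "0 < t" by simp
  show thesis
  proof
    show "g \<in> {0..1}" by fact
    show "u + g *\<^sub>R v \<in> cone"
      by (rule entry_le(1)[OF t n])
    fix g' :: real
    assume g': "g' \<in> {0..1}" "u + g' *\<^sub>R v \<in> cone"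
    have "t \<le> entry (u + g' *\<^sub>R v)"
    proof (cases "entry (u + g' *\<^sub>R v) \<le> entry u")
      case True
      then have "(g', entry (u + g' *\<^sub>R v)) \<in> C"
        using g' entry_pos[OF g'(2)] norm_inward[OF g'(2)] by (simp add: C_def inward_def)
      then show ?thesis
        using c(2) gt by auto
    qed (use tu in simp)
    with entry_le(2)[OF t n] show "entry (u + g *\<^sub>R v) \<le> entry (u + g' *\<^sub>R v)"
      by simp
  qed
qed

lemma entry_less_left:
  assumes u: "u \<in> cone" and v: "v \<noteq> 0" and le: "inward u \<bullet> v \<le> 0"
    and no_ray: "\<not> (disc u = 0 \<and> (\<exists>t>0. v = t *\<^sub>R u))"
    and g: "0 < g" and z: "u + g *\<^sub>R v \<in> cone"
  shows "entry u < entry (u + g *\<^sub>R v)"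
proof (rule entry_less_cases[OF u z])
  show "u + g *\<^sub>R v \<noteq> u"
    using g v by simp
  show "inward u \<bullet> (u + g *\<^sub>R v - u) \<le> 0"
    using g le by (simp add: mult_le_0_iff)
  fix k :: real
  assume k: "disc u = 0" "1 < k" "u + g *\<^sub>R v = k *\<^sub>R u"
  have "g *\<^sub>R v = (k - 1) *\<^sub>R u"
    using k(3) by (simp add: algebra_simps)
  from arg_cong[OF this, of "\<lambda>w. (1 / g) *\<^sub>R w"] g have "v = ((k - 1) / g) *\<^sub>R u"
    by simp
  moreover have "0 < (k - 1) / g"
    using k(2) g by simp
  ultimately show ?thesis
    using no_ray k(1) by blast
qed

lemma entry_less_right:
  assumes u: "u \<in> cone" and y: "u + v \<in> cone" and v: "v \<noteq> 0" and ge: "0 \<le> inward (u + v) \<bullet> v"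
    and no_ray: "\<not> (disc u = 0 \<and> (\<exists>t<0. v = t *\<^sub>R u))"
    and g: "g < 1" and z: "u + g *\<^sub>R v \<in> cone"
  shows "entry (u + v) < entry (u + g *\<^sub>R v)"
proof (rule entry_less_cases[OF y z])
  have diff: "u + g *\<^sub>R v - (u + v) = (g - 1) *\<^sub>R v"
    by (simp add: algebra_simps)
  show "u + g *\<^sub>R v \<noteq> u + v"
    using g v diff by auto
  show "inward (u + v) \<bullet> (u + g *\<^sub>R v - (u + v)) \<le> 0"
    unfolding diff using g ge by (simp add: mult_le_0_iff)
  fix k :: real
  assume k: "disc (u + v) = 0" "1 < k" "u + g *\<^sub>R v = k *\<^sub>R (u + v)"
  \<comment> \<open>Obtained by solving \<open>k(3)\<close> for \<open>v\<close>. Here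
    \<open>1 + t = (1 - g) / (k - g)\<close> is nonzero because \<open>g < 1\<close>, so tangency
    passes from \<open>u + v\<close> back to \<open>u\<close>.\<close>
  define t where "t = - ((k - 1) / (k - g))"
  have "(k - g) *\<^sub>R v = - ((k - 1) *\<^sub>R u)"
    using k(3) by (simp add: algebra_simps)
  from arg_cong[OF this, of "\<lambda>w. (1 / (k - g)) *\<^sub>R w"] g k(2) have vt: "v = t *\<^sub>R u"
    by (simp add: t_def)
  have t: "t < 0" "1 + t \<noteq> 0"
    using k(2) g by (auto simp: t_def divide_simps)
  have "disc ((1 + t) *\<^sub>R u) = 0"
    using k(1) by (simp add: vt scaleR_add_left)
  then have "disc u = 0"
    using t by (simp add: disc_scaleR)
  then show ?thesis
    using no_ray t vt by blast
qed

text \<open>Otherwise \<open>u\<close> would be a multiple of \<open>u + g *\<^sub>R v\<close>, and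
  a positive one since both have positive inner product with \<open>x\<close>. But
  \<open>inward\<close> is constant along rays, against \<open>eq\<close> and \<open>ne\<close>.
  This excludes the ray alternative of \<open>entry_less_cases\<close> at an interior
  minimizer.\<close>

lemma not_parallel:
  assumes u: "u \<in> cone" and y: "u + g *\<^sub>R v \<in> cone"
    and eq: "inward (u + g *\<^sub>R v) \<bullet> v = 0" and ne: "inward u \<bullet> v \<noteq> 0"
  shows "v \<noteq> t *\<^sub>R (u + g *\<^sub>R v)"
proof
  assume v: "v = t *\<^sub>R (u + g *\<^sub>R v)"
  define y' where "y' = u + g *\<^sub>R v"
  have "v = t *\<^sub>R y'"
    using v by (simp only: y'_def)
  moreover have "u = y' - g *\<^sub>R v"
    by (simp add: y'_def)
  ultimately have "u = (1 - g * t) *\<^sub>R y'"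
    by (simp add: scaleR_diff_left)
  then have u': "u = (1 - g * t) *\<^sub>R (u + g *\<^sub>R v)"
    by (simp only: y'_def)
  have "0 < (1 - g * t) * (x \<bullet> (u + g *\<^sub>R v))"
    using u arg_cong[OF u', of "\<lambda>w. x \<bullet> w"] by (simp add: cone_def)
  then have "0 < 1 - g * t"
    using y by (simp add: cone_def zero_less_mult_iff)
  then have "inward u = inward (u + g *\<^sub>R v)"
    using inward_scaleR[of "1 - g * t" "u + g *\<^sub>R v"] u' by simp
  with eq ne show False by simp
qed

text \<open>First-order conditions at a minimizer: \<open>improving_direction\<close> is applied to
  \<open>v\<close> unless \<open>g = 1\<close> and to \<open>- v\<close> unless
  \<open>g = 0\<close>. The sign hypotheses at the end points then exclude both of them.\<close>

lemma interior_minimizer: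
  assumes u: "u \<in> cone" and left: "0 < inward u \<bullet> v"
    and right: "u + v \<in> cone \<Longrightarrow> inward (u + v) \<bullet> v < 0"
  obtains g where "0 < g" "g < 1" "u + g *\<^sub>R v \<in> cone" "inward (u + g *\<^sub>R v) \<bullet> v = 0"
proof -
  obtain g where g: "g \<in> {0..1}" "u + g *\<^sub>R v \<in> cone"
    and min: "\<And>g'. g' \<in> {0..1} \<Longrightarrow> u + g' *\<^sub>R v \<in> cone
      \<Longrightarrow> entry (u + g *\<^sub>R v) \<le> entry (u + g' *\<^sub>R v)"
    using entry_minimizer_exists[OF u, of v] by blast
  define y where "y = u + g *\<^sub>R v"
  have le: "inward y \<bullet> v \<le> 0" if "g < 1"
  proof (rule ccontr)
    assume "\<not> inward y \<bullet> v \<le> 0"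
    then obtain r where r: "0 < r"
      "\<And>\<delta>. 0 < \<delta> \<Longrightarrow> \<delta> < r \<Longrightarrow> y + \<delta> *\<^sub>R v \<in> cone \<and> entry (y + \<delta> *\<^sub>R v) < entry y"
      using improving_direction[of y v] g(2) y_def by (metis not_le)
    define \<delta> where "\<delta> = min (r / 2) (1 - g)"
    have \<delta>: "0 < \<delta>" "\<delta> < r" "g + \<delta> \<in> {0..1}"
      using r(1) that g(1) by (auto simp: \<delta>_def min_def)
    have "y + \<delta> *\<^sub>R v = u + (g + \<delta>) *\<^sub>R v"
      by (simp add: y_def scaleR_add_left)
    with r(2)[OF \<delta>(1,2)] min[OF \<delta>(3)] show False
      by (simp add: y_def[symmetric])
  qed
  have ge: "0 \<le> inward y \<bullet> v" if "0 < g"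
  proof (rule ccontr)
    assume "\<not> 0 \<le> inward y \<bullet> v"
    then have "0 < inward y \<bullet> (- v)"
      by simp
    then obtain r where r: "0 < r"
      "\<And>\<delta>. 0 < \<delta> \<Longrightarrow> \<delta> < r \<Longrightarrow> y + \<delta> *\<^sub>R (- v) \<in> cone \<and> entry (y + \<delta> *\<^sub>R (- v)) < entry y"
      using improving_direction[of y "- v"] g(2) y_def by metis
    define \<delta> where "\<delta> = min (r / 2) g"
    have \<delta>: "0 < \<delta>" "\<delta> < r" "g - \<delta> \<in> {0..1}"
      using r(1) that g(1) by (auto simp: \<delta>_def min_def)
    have "y + \<delta> *\<^sub>R (- v) = u + (g - \<delta>) *\<^sub>R v"
      by (simp add: y_def scaleR_diff_left)
    with r(2)[OF \<delta>(1,2)] min[OF \<delta>(3)] show False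
      by (simp del: scaleR_minus_right add: y_def[symmetric])
  qed
  have "g \<noteq> 0"
    using le left by (auto simp: y_def)
  moreover have "g \<noteq> 1"
    using ge right g(2) by (auto simp: y_def)
  ultimately have "0 < g" "g < 1"
    using g(1) by auto
  with le ge g(2) show thesis
    by (intro that) (auto simp: y_def)
qed

lemma entry_less_interior:
  assumes y: "y \<in> cone" and z: "y + \<delta> *\<^sub>R v \<in> cone" and "\<delta> \<noteq> 0"
    and eq: "inward y \<bullet> v = 0" and np: "\<And>t. v \<noteq> t *\<^sub>R y"
  shows "entry y < entry (y + \<delta> *\<^sub>R v)"
proof (rule entry_less_cases[OF y z])
  show "y + \<delta> *\<^sub>R v \<noteq> y"
    using np[of 0] \<open>\<delta> \<noteq> 0\<close> by simp
  show "inward y \<bullet> (y + \<delta> *\<^sub>R v - y) \<le> 0"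
    using eq by simp
  fix k assume "y + \<delta> *\<^sub>R v = k *\<^sub>R y"
  then have "\<delta> *\<^sub>R v = (k - 1) *\<^sub>R y"
    by (simp add: algebra_simps)
  from arg_cong[OF this, of "\<lambda>w. (1 / \<delta>) *\<^sub>R w"] \<open>\<delta> \<noteq> 0\<close> have "v = ((k - 1) / \<delta>) *\<^sub>R y"
    by simp
  with np show ?thesis by blast
qed

section \<open>The quadratic equation and its selecting inequality\<close>

definition stationary :: "'v \<Rightarrow> 'v \<Rightarrow> bool" where
  "stationary z v \<longleftrightarrow>
     (z \<bullet> z) * (x \<bullet> v)\<^sup>2 - 2 * (x \<bullet> z) * (x \<bullet> v) * (z \<bullet> v) + M * (z \<bullet> v)\<^sup>2 = 0 \<and>
     (x \<bullet> v \<noteq> 0 \<longrightarrow> (x \<bullet> z) / M \<le> (z \<bullet> v) / (x \<bullet> v))"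

text \<open>With \<open>t = entry z\<close>, orthogonality reads
  \<open>x \<bullet> v = t * (z \<bullet> v)\<close>; substituting this turns the left-hand side
  into the polynomial of \<open>entry_root\<close> times \<open>(z \<bullet> v)\<^sup>2\<close>. The
  inequality is \<open>(x \<bullet> z) / M \<le> 1 / t\<close>, where \<open>1 / t\<close> has the
  additional summand \<open>sqrt (disc z) / M\<close>.\<close>

lemma stationaryI:
  assumes z: "z \<in> cone" and eq: "inward z \<bullet> v = 0"
  shows "stationary z v"
proof -
  define t where "t = entry z"
  have xv: "x \<bullet> v = t * (z \<bullet> v)"
    using eq by (simp add: inward_def t_def inner_diff_left)
  have "(z \<bullet> z) * (x \<bullet> v)\<^sup>2 - 2 * (x \<bullet> z) * (x \<bullet> v) * (z \<bullet> v) + M * (z \<bullet> v)\<^sup>2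
      = (M - 2 * t * (x \<bullet> z) + t\<^sup>2 * (z \<bullet> z)) * (z \<bullet> v)\<^sup>2"
    unfolding xv by (simp add: power2_eq_square algebra_simps)
  also have "\<dots> = 0"
    using entry_root[OF z] by (simp add: t_def)
  finally have root: "(z \<bullet> z) * (x \<bullet> v)\<^sup>2 - 2 * (x \<bullet> z) * (x \<bullet> v) * (z \<bullet> v) + M * (z \<bullet> v)\<^sup>2 = 0" .
  have "0 < x \<bullet> z" "0 \<le> sqrt (disc z)"
    using z by (auto simp: cone_def)
  then have "(x \<bullet> z) / M \<le> 1 / t"
    using M_pos by (simp add: t_def entry_def divide_right_mono)
  with root xv show ?thesis
    by (auto simp: stationary_def)
qed

text \<open>If \<open>x \<bullet> v\<close> is nonzero and \<open>s\<close> is positive,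
  \<open>z\<close> is itself a point of the cone with \<open>inward z\<close> orthogonal to
  \<open>v\<close>, so \<open>entry_less_interior\<close> makes each of \<open>y\<close> and
  \<open>z\<close> strictly better than the other. In the remaining cases, \<open>v\<close> would
  vanish or \<open>z\<close> would be a multiple of \<open>y\<close>.\<close>

lemma stationary_unique:
  assumes y: "y \<in> cone" and eq: "inward y \<bullet> v = 0" and np: "\<And>t. v \<noteq> t *\<^sub>R y"
    and st: "stationary (y + \<delta> *\<^sub>R v) v"
  shows "\<delta> = 0"
proof (rule ccontr)
  assume \<delta>: "\<delta> \<noteq> 0"
  define z where "z = y + \<delta> *\<^sub>R v"
  have not_mult: "z \<noteq> c *\<^sub>R y" for c
  proof
    assume "z = c *\<^sub>R y"
    then have "\<delta> *\<^sub>R v = (c - 1) *\<^sub>R y"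
      by (simp add: z_def algebra_simps)
    from arg_cong[OF this, of "\<lambda>w. (1 / \<delta>) *\<^sub>R w"] \<delta> np show False
      by simp
  qed
  have root: "(z \<bullet> z) * (x \<bullet> v)\<^sup>2 - 2 * (x \<bullet> z) * (x \<bullet> v) * (z \<bullet> v) + M * (z \<bullet> v)\<^sup>2 = 0"
    and sel: "x \<bullet> v \<noteq> 0 \<Longrightarrow> (x \<bullet> z) / M \<le> (z \<bullet> v) / (x \<bullet> v)"
    using st by (auto simp: stationary_def z_def)
  have "v \<noteq> 0"
    using np[of 0] by simp
  show False
  proof (cases "x \<bullet> v = 0")
    case True
    then have "z \<bullet> v = 0"
      using root M_pos by simp
    moreover have "y \<bullet> v = 0"
      using eq True entry_pos[OF y] by (simp add: inward_def inner_diff_left)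
    ultimately show False
      using \<delta> \<open>v \<noteq> 0\<close> by (simp add: z_def inner_add_left)
  next
    case False
    \<comment> \<open>The reciprocal of the candidate for \<open>entry z\<close>, as suggested by
      \<open>x \<bullet> v = t * (z \<bullet> v)\<close>. The quadratic equation then puts
      \<open>z / s\<close> on the sphere when \<open>s\<close> is nonzero, and the selecting
      inequality becomes \<open>near\<close>.\<close>
    define s where "s = (z \<bullet> v) / (x \<bullet> v)"
    have zv: "z \<bullet> v = s * (x \<bullet> v)"
      using False by (simp add: s_def)
    have "(x \<bullet> v)\<^sup>2 * (z \<bullet> z - 2 * s * (x \<bullet> z) + M * s\<^sup>2) = 0"
      using root unfolding zv by (simp add: power2_eq_square algebra_simps)
    then have quad: "z \<bullet> z = 2 * s * (x \<bullet> z) - M * s\<^sup>2"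
      using False by simp
    have near: "x \<bullet> z \<le> M * s"
      using sel[OF False] M_pos by (simp add: s_def[symmetric] pos_divide_le_eq mult.commute)
    have root': "M - 2 * (1 / s) * (x \<bullet> z) + (1 / s)\<^sup>2 * (z \<bullet> z) = 0" if "s \<noteq> 0"
      using that unfolding quad by (simp add: power2_eq_square field_simps)
    consider "s = 0" | "0 < s" | "s < 0" by linarith
    then show False
    proof cases
      case 1
      then have "z = 0"
        using quad by simp
      then show False
        using not_mult[of 0] by simp
    next
      case 2
      have "(x - (1 / s) *\<^sub>R z) \<bullet> z = M * s - x \<bullet> z"
        unfolding inner_diff_left inner_scaleR_left quad
        using 2 by (simp add: power2_eq_square field_simps)
      then have z: "z \<in> cone" "entry z = 1 / s"
        using entry_eqI[of "1 / s" z] root' near 2 by auto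
      have eq': "inward z \<bullet> v = 0"
        using 2 by (simp add: inward_def z(2) inner_diff_left zv)
      have "v \<noteq> t *\<^sub>R z" for t
      proof
        assume v: "v = t *\<^sub>R z"
        have "y = z - \<delta> *\<^sub>R v"
          by (simp add: z_def)
        also have "\<dots> = (1 - \<delta> * t) *\<^sub>R z"
          by (simp add: v scaleR_diff_left)
        finally have "y = (1 - \<delta> * t) *\<^sub>R z" .
        then show False
          using not_mult[of "1 / (1 - \<delta> * t)"] cone_nonzero[OF y] by auto
      qed
      then have "entry z < entry (z + (- \<delta>) *\<^sub>R v)"
        using entry_less_interior[of z "- \<delta>" v] z(1) y \<delta> eq' by (simp add: z_def)
      moreover have "entry y < entry z"
        using entry_less_interior[of y \<delta> v] z(1) y \<delta> eq np by (simp add: z_def)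
      ultimately show False
        by (simp add: z_def)
    next
      case 3
      \<comment> \<open>The ball point \<open>z / s\<close> satisfies \<open>inward y \<bullet> (z / s) \<le> 0\<close>, so it can only be the
        entry point of \<open>y\<close> itself.\<close>
      have "(norm (x - (1 / s) *\<^sub>R z))\<^sup>2 = \<epsilon>\<^sup>2"
        using root' 3 unfolding norm_diff_scaleR by simp
      then have "norm (x - (1 / s) *\<^sub>R z) \<le> \<epsilon>"
        using eps_pos by (simp add: power2_eq_iff_nonneg)
      then have "(norm ((1 / s) *\<^sub>R z - entry y *\<^sub>R y))\<^sup>2
          \<le> 2 * (inward y \<bullet> ((1 / s) *\<^sub>R z - entry y *\<^sub>R y))"
        by (rule supporting_hyperplane[OF y])
      also have "inward y \<bullet> ((1 / s) *\<^sub>R z - entry y *\<^sub>R y) = (1 / s - entry y) * sqrt (disc y)"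
        using eq inward_inner[OF y]
        by (simp add: z_def inner_diff_right inner_add_right left_diff_distrib)
      also have "2 * \<dots> \<le> 0"
      proof -
        have "1 / s < 0"
          using 3 by simp
        then have "1 / s - entry y \<le> 0"
          using entry_pos[OF y] by linarith
        moreover have "0 \<le> sqrt (disc y)"
          using y by (simp add: cone_def)
        ultimately show ?thesis
          by (simp add: mult_le_0_iff)
      qed
      finally have "(1 / s) *\<^sub>R z = entry y *\<^sub>R y"
        by simp
      from arg_cong[OF this, of "\<lambda>w. s *\<^sub>R w"] 3 have "z = (s * entry y) *\<^sub>R y"
        by simp
      then show False
        using not_mult by blast
    qed
  qed
qed

end

section \<open>Translation of the optimization problem into the cone\<close>

locale cone_search = ball_cone x \<epsilon> for x :: "'v::euclidean_space" and \<epsilon> +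
  fixes \<phi> :: "'h::euclidean_space \<Rightarrow> 'v"
  assumes lin: "linear \<phi>"
begin

lemma phi_step: "\<phi> (h + \<gamma> *\<^sub>R d) = \<phi> h + \<gamma> *\<^sub>R \<phi> d"
  by (simp add: linear_add[OF lin] linear_scale[OF lin])

lemma norm_sq_err: "(\<phi> h \<bullet> \<phi> h) * (\<epsilon>\<^sup>2 - err x \<phi> h) = disc (\<phi> h)" if "\<phi> h \<noteq> 0"
proof -
  have "\<phi> h \<bullet> \<phi> h \<noteq> 0"
    using that by simp
  then show ?thesis
    using that
    by (simp add: err_eq disc_def M_def power2_norm_eq_inner[of "\<phi> h"] field_simps)
qed

lemma feas_iff: "h \<in> feas x \<phi> \<epsilon> \<longleftrightarrow> \<phi> h \<in> cone"
proof (cases "\<phi> h = 0")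
  case False
  then have "0 < \<phi> h \<bullet> \<phi> h"
    by simp
  then have "0 \<le> disc (\<phi> h) \<longleftrightarrow> err x \<phi> h \<le> \<epsilon>\<^sup>2"
    by (simp add: norm_sq_err[OF False, symmetric] zero_le_mult_iff not_le[symmetric]
        del: inner_gt_zero_iff)
  then show ?thesis
    by (simp add: feas_def cone_def)
qed (simp add: feas_def cone_def)

lemma eta_eq_entry: "eta x \<phi> \<epsilon> h = entry (\<phi> h)" if "\<phi> h \<noteq> 0"
proof -
  have "norm (\<phi> h) * sqrt (\<epsilon>\<^sup>2 - err x \<phi> h) = sqrt (disc (\<phi> h))"
    by (simp add: norm_sq_err[OF that, symmetric] real_sqrt_mult norm_eq_sqrt_inner)
  then show ?thesis
    by (simp add: eta_def entry_def M_def)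
qed

lemma err_boundary_iff: "err x \<phi> h = \<epsilon>\<^sup>2 \<longleftrightarrow> disc (\<phi> h) = 0" if "\<phi> h \<noteq> 0"
  using that by (auto simp: norm_sq_err[OF that, symmetric])

lemma eta_ext_eq:
  "eta_ext x \<phi> \<epsilon> h = (if \<phi> h \<in> cone then ereal (entry (\<phi> h)) else \<infinity>)"
  using cone_nonzero by (auto simp: eta_ext_def feas_iff eta_eq_entry)

lemma cond_left_iff: "cond_left x \<phi> \<epsilon> h d \<longleftrightarrow> inward (\<phi> h) \<bullet> \<phi> d \<le> 0" if "\<phi> h \<in> cone"
  using cone_nonzero[OF that] by (simp add: cond_left_def eta_eq_entry inward_def inner_diff_left)

lemma cond_right_iff:
  "cond_right x \<phi> \<epsilon> h d \<longleftrightarrow> \<phi> h + \<phi> d \<in> cone \<and> 0 \<le> inward (\<phi> h + \<phi> d) \<bullet> \<phi> d"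
proof -
  have "\<phi> (h + d) = \<phi> h + \<phi> d"
    by (simp add: linear_add[OF lin])
  then show ?thesis
    using cone_nonzero[of "\<phi> h + \<phi> d"]
    by (auto simp: cond_right_def feas_iff eta_eq_entry inward_def inner_diff_left)
qed

text \<open>Only parameters within the cone have to be compared: elsewhere \<open>eta_ext\<close> is
  infinite, while it is finite at \<open>g\<close>.\<close>

lemma argmin_set_eq_singleton:
  assumes "g \<in> {0..1}" and "\<phi> h + g *\<^sub>R \<phi> d \<in> cone"
    and less: "\<And>g'. g' \<in> {0..1} \<Longrightarrow> g' \<noteq> g \<Longrightarrow> \<phi> h + g' *\<^sub>R \<phi> d \<in> cone
      \<Longrightarrow> entry (\<phi> h + g *\<^sub>R \<phi> d) < entry (\<phi> h + g' *\<^sub>R \<phi> d)"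
  shows "argmin_set x \<phi> \<epsilon> h d = {g}"
proof -
  have less': "eta_ext x \<phi> \<epsilon> (h + g *\<^sub>R d) < eta_ext x \<phi> \<epsilon> (h + g' *\<^sub>R d)"
    if "g' \<in> {0..1}" "g' \<noteq> g" for g'
    using assms(2) less[OF that] by (simp add: eta_ext_eq phi_step)
  have "is_arg_min (\<lambda>\<gamma>. eta_ext x \<phi> \<epsilon> (h + \<gamma> *\<^sub>R d)) (\<lambda>\<gamma>. \<gamma> \<in> {0..1}) \<gamma> \<longleftrightarrow> \<gamma> = g" for \<gamma>
    unfolding is_arg_min_def using assms(1) less' by (metis less_asym less_irrefl)
  then show ?thesis
    by (simp add: argmin_set_def)
qed

text \<open>Multiplying the quadratic in \<gamma> by \<open>v \<bullet> v\<close> clears the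
  denominators of \<open>coeff_c\<close> and collects everything into a form in the point
  \<open>u + \<gamma> *\<^sub>R v\<close>, so that roots can be treated geometrically.\<close>

lemma selected_root_iff:
  assumes "\<phi> d \<noteq> 0"
  shows "selected_root x \<phi> \<epsilon> h d \<gamma> \<longleftrightarrow> stationary (\<phi> h + \<gamma> *\<^sub>R \<phi> d) (\<phi> d)"
proof -
  define u v where "u = \<phi> h" and "v = \<phi> d"
  have v: "v \<bullet> v \<noteq> 0"
    using assms by (simp add: v_def)
  have a: "coeff_a x \<phi> \<epsilon> d = M * (v \<bullet> v) - (x \<bullet> v)\<^sup>2"
    using norm_sq_err[OF assms]
    by (simp add: coeff_a_def power2_norm_eq_inner[of "\<phi> d"] v_def disc_def algebra_simps)
  have b: "coeff_b x \<phi> \<epsilon> h d = M * (u \<bullet> v) - (x \<bullet> u) * (x \<bullet> v)"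
    by (simp add: coeff_b_def M_def u_def v_def)
  have c: "(v \<bullet> v) * coeff_c x \<phi> \<epsilon> h d
      = M * (u \<bullet> v)\<^sup>2 - 2 * (x \<bullet> v) * (x \<bullet> u) * (u \<bullet> v) + (u \<bullet> u) * (x \<bullet> v)\<^sup>2"
    using v unfolding coeff_c_def M_def[symmetric] u_def[symmetric] v_def[symmetric]
      power2_norm_eq_inner[of u] power2_norm_eq_inner[of v]
    by (simp add: field_simps)
  have "(v \<bullet> v) * (coeff_a x \<phi> \<epsilon> d * \<gamma>\<^sup>2 + 2 * coeff_b x \<phi> \<epsilon> h d * \<gamma> + coeff_c x \<phi> \<epsilon> h d)
      = (v \<bullet> v) * (coeff_a x \<phi> \<epsilon> d * \<gamma>\<^sup>2 + 2 * coeff_b x \<phi> \<epsilon> h d * \<gamma>)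
        + (v \<bullet> v) * coeff_c x \<phi> \<epsilon> h d"
    by (simp add: algebra_simps)
  also have "\<dots> = ((u + \<gamma> *\<^sub>R v) \<bullet> (u + \<gamma> *\<^sub>R v)) * (x \<bullet> v)\<^sup>2
      - 2 * (x \<bullet> (u + \<gamma> *\<^sub>R v)) * (x \<bullet> v) * ((u + \<gamma> *\<^sub>R v) \<bullet> v)
      + M * ((u + \<gamma> *\<^sub>R v) \<bullet> v)\<^sup>2"
    unfolding c a b
    by (simp add: inner_add inner_commute[of v u] power2_eq_square algebra_simps)
  finally have "coeff_a x \<phi> \<epsilon> d * \<gamma>\<^sup>2 + 2 * coeff_b x \<phi> \<epsilon> h d * \<gamma> + coeff_c x \<phi> \<epsilon> h d = 0
    \<longleftrightarrow> ((u + \<gamma> *\<^sub>R v) \<bullet> (u + \<gamma> *\<^sub>R v)) * (x \<bullet> v)\<^sup>2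
      - 2 * (x \<bullet> (u + \<gamma> *\<^sub>R v)) * (x \<bullet> v) * ((u + \<gamma> *\<^sub>R v) \<bullet> v)
      + M * ((u + \<gamma> *\<^sub>R v) \<bullet> v)\<^sup>2 = 0"
    using v by (metis mult_eq_0_iff)
  then show ?thesis
    unfolding selected_root_def stationary_def phi_step M_def[symmetric]
      u_def[symmetric] v_def[symmetric] by simp
qed

lemma outward_ray_iff:
  "outward_ray x \<phi> \<epsilon> h d \<longleftrightarrow> disc (\<phi> h) = 0 \<and> (\<exists>t>0. \<phi> d = t *\<^sub>R \<phi> h)" if "\<phi> h \<in> cone"
  using cone_nonzero[OF that] by (simp add: outward_ray_def err_boundary_iff)

lemma inward_ray_iff:
  "inward_ray x \<phi> \<epsilon> h d \<longleftrightarrow> disc (\<phi> h) = 0 \<and> (\<exists>t<0. \<phi> d = t *\<^sub>R \<phi> h)" if "\<phi> h \<in> cone"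
  using cone_nonzero[OF that] by (simp add: inward_ray_def err_boundary_iff)

section \<open>The three cases and the degenerate rays\<close>

lemma argmin_left:
  assumes "\<phi> h \<in> cone" "\<phi> d \<noteq> 0" "cond_left x \<phi> \<epsilon> h d" "\<not> outward_ray x \<phi> \<epsilon> h d"
  shows "argmin_set x \<phi> \<epsilon> h d = {0}"
proof (rule argmin_set_eq_singleton)
  fix g' :: real
  assume "g' \<in> {0..1}" "g' \<noteq> 0" "\<phi> h + g' *\<^sub>R \<phi> d \<in> cone"
  then show "entry (\<phi> h + 0 *\<^sub>R \<phi> d) < entry (\<phi> h + g' *\<^sub>R \<phi> d)"
    using entry_less_left[of "\<phi> h" "\<phi> d" g'] assms by (simp add: cond_left_iff outward_ray_iff)
qed (use assms in auto)

lemma argmin_right: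
  assumes "\<phi> h \<in> cone" "\<phi> d \<noteq> 0" "cond_right x \<phi> \<epsilon> h d" "\<not> inward_ray x \<phi> \<epsilon> h d"
  shows "argmin_set x \<phi> \<epsilon> h d = {1}"
proof (rule argmin_set_eq_singleton)
  fix g' :: real
  assume "g' \<in> {0..1}" "g' \<noteq> 1" "\<phi> h + g' *\<^sub>R \<phi> d \<in> cone"
  then show "entry (\<phi> h + 1 *\<^sub>R \<phi> d) < entry (\<phi> h + g' *\<^sub>R \<phi> d)"
    using entry_less_right[of "\<phi> h" "\<phi> d" g'] assms by (simp add: cond_right_iff inward_ray_iff)
qed (use assms in \<open>auto simp: cond_right_iff\<close>)

lemma argmin_interior:
  assumes u: "\<phi> h \<in> cone" and left: "\<not> cond_left x \<phi> \<epsilon> h d" and right: "\<not> cond_right x \<phi> \<epsilon> h d"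
  obtains g where "argmin_set x \<phi> \<epsilon> h d = {g}" "alt_interior x \<phi> \<epsilon> h d g"
proof -
  have ne: "0 < inward (\<phi> h) \<bullet> \<phi> d"
    using left u by (simp add: cond_left_iff)
  then have v: "\<phi> d \<noteq> 0"
    by auto
  obtain g where g: "0 < g" "g < 1" "\<phi> h + g *\<^sub>R \<phi> d \<in> cone" "inward (\<phi> h + g *\<^sub>R \<phi> d) \<bullet> \<phi> d = 0"
    using interior_minimizer[OF u ne] right unfolding cond_right_iff by (metis not_le)
  have np: "\<phi> d \<noteq> t *\<^sub>R (\<phi> h + g *\<^sub>R \<phi> d)" for t
    using not_parallel[OF u g(3,4)] ne by simp
  \<comment> \<open>Re-centres the line at the minimizer, where \<open>entry_less_interior\<close>
    and \<open>stationary_unique\<close> measure displacements.\<close>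
  have step: "\<phi> h + g' *\<^sub>R \<phi> d = (\<phi> h + g *\<^sub>R \<phi> d) + (g' - g) *\<^sub>R \<phi> d" for g'
    by (simp add: scaleR_diff_left)
  have "argmin_set x \<phi> \<epsilon> h d = {g}"
  proof (rule argmin_set_eq_singleton)
    fix g' :: real
    assume "g' \<noteq> g" "\<phi> h + g' *\<^sub>R \<phi> d \<in> cone"
    then show "entry (\<phi> h + g *\<^sub>R \<phi> d) < entry (\<phi> h + g' *\<^sub>R \<phi> d)"
      unfolding step[of g'] by (intro entry_less_interior g np) auto
  qed (use g in auto)
  moreover have unique: "g' = g" if "stationary (\<phi> h + g' *\<^sub>R \<phi> d) (\<phi> d)" for g'
  proof -
    have "g' - g = 0"
      using that unfolding step[of g'] by (rule stationary_unique[OF g(3,4) np])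
    then show ?thesis by simp
  qed
  have "alt_interior x \<phi> \<epsilon> h d g"
    unfolding alt_interior_def selected_root_iff[OF v]
    using left right greaterThanLessThan_iff g(1,2) stationaryI[OF g(3,4)] unique by blast
  ultimately show thesis
    by (rule that)
qed

text \<open>The end point is a positive multiple of \<open>\<phi> h\<close>, so it has the same
  \<open>inward\<close>, which is orthogonal to the tangent ray. Thus the directions excluded in
  \<open>argmin_left\<close> are covered by \<open>argmin_right\<close>.\<close>

lemma outward_ray_imp:
  assumes u: "\<phi> h \<in> cone" and ray: "outward_ray x \<phi> \<epsilon> h d"
  shows "cond_right x \<phi> \<epsilon> h d" "\<not> inward_ray x \<phi> \<epsilon> h d"
proof -
  obtain t where t: "disc (\<phi> h) = 0" "0 < t" "\<phi> d = t *\<^sub>R \<phi> h"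
    using ray u by (auto simp: outward_ray_iff)
  have y: "\<phi> h + \<phi> d = (1 + t) *\<^sub>R \<phi> h"
    by (simp add: t scaleR_add_left)
  show "cond_right x \<phi> \<epsilon> h d"
    unfolding cond_right_iff y
    using t u inward_inner[OF u] by (simp add: cone_scaleR inward_scaleR)
  show "\<not> inward_ray x \<phi> \<epsilon> h d"
    using t cone_nonzero[OF u] by (auto simp: inward_ray_iff[OF u])
qed

lemma inward_ray_imp:
  assumes u: "\<phi> h \<in> cone" and ray: "inward_ray x \<phi> \<epsilon> h d"
  shows "cond_left x \<phi> \<epsilon> h d"
  using ray inward_inner[OF u] by (auto simp: cond_left_iff[OF u] inward_ray_iff[OF u])

end

theorem proposition3p3:
  fixes \<phi> :: "'h::euclidean_space \<Rightarrow> 'v::euclidean_space"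
    and x :: 'v and \<epsilon> :: real and h d :: 'h
  assumes "linear \<phi>"
    and "norm x > \<epsilon>" and "\<epsilon> > 0"
    and "\<exists>f. norm (x - \<phi> f) < \<epsilon>"
    and "h \<in> feas x \<phi> \<epsilon>"
  shows "(\<phi> d \<noteq> 0 \<longrightarrow>
      (\<exists>\<gamma>. argmin_set x \<phi> \<epsilon> h d = {\<gamma>} \<and>
        (alt_left x \<phi> \<epsilon> h d \<gamma> \<and> \<not> alt_right x \<phi> \<epsilon> h d \<gamma> \<and> \<not> alt_interior x \<phi> \<epsilon> h d \<gamma> \<or>
         \<not> alt_left x \<phi> \<epsilon> h d \<gamma> \<and> alt_right x \<phi> \<epsilon> h d \<gamma> \<and> \<not> alt_interior x \<phi> \<epsilon> h d \<gamma> \<or>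
         \<not> alt_left x \<phi> \<epsilon> h d \<gamma> \<and> \<not> alt_right x \<phi> \<epsilon> h d \<gamma> \<and> alt_interior x \<phi> \<epsilon> h d \<gamma>) \<and>
        (cond_left x \<phi> \<epsilon> h d \<and> \<not> outward_ray x \<phi> \<epsilon> h d \<longrightarrow> \<gamma> = 0) \<and>
        (cond_right x \<phi> \<epsilon> h d \<and> \<not> inward_ray x \<phi> \<epsilon> h d \<longrightarrow> \<gamma> = 1) \<and>
        (\<not> cond_left x \<phi> \<epsilon> h d \<and> \<not> cond_right x \<phi> \<epsilon> h d \<longrightarrow> alt_interior x \<phi> \<epsilon> h d \<gamma>))) \<and>
    (\<phi> d = 0 \<longrightarrow>
      cond_left x \<phi> \<epsilon> h d \<and> cond_right x \<phi> \<epsilon> h d \<and> argmin_set x \<phi> \<epsilon> h d = {0..1})"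
proof -
  interpret cone_search x \<epsilon> \<phi>
    using assms(1-3) by (intro cone_search.intro ball_cone.intro cone_search_axioms.intro)
  have u: "\<phi> h \<in> cone"
    using assms(5) by (simp add: feas_iff)
  note alts = alt_left_def alt_right_def alt_interior_def
  show ?thesis
  proof (intro conjI impI)
    assume v: "\<phi> d \<noteq> 0"
    note argmin = argmin_left[OF u v] argmin_right[OF u v]
    \<comment> \<open>Exhaustive, since an outward ray falls under \<open>right\<close> and an
      inward ray under \<open>left\<close>. The first two cases exclude each other because the
      minimizer set would be both {0} and {1}; this also settles which alternative holds.\<close>
    consider (left) "cond_left x \<phi> \<epsilon> h d" "\<not> outward_ray x \<phi> \<epsilon> h d"
      | (right) "cond_right x \<phi> \<epsilon> h d" "\<not> inward_ray x \<phi> \<epsilon> h d"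
      | (interior) "\<not> cond_left x \<phi> \<epsilon> h d" "\<not> cond_right x \<phi> \<epsilon> h d"
      using outward_ray_imp[OF u] inward_ray_imp[OF u] by blast
    then show "\<exists>\<gamma>. argmin_set x \<phi> \<epsilon> h d = {\<gamma>} \<and>
        (alt_left x \<phi> \<epsilon> h d \<gamma> \<and> \<not> alt_right x \<phi> \<epsilon> h d \<gamma> \<and> \<not> alt_interior x \<phi> \<epsilon> h d \<gamma> \<or>
         \<not> alt_left x \<phi> \<epsilon> h d \<gamma> \<and> alt_right x \<phi> \<epsilon> h d \<gamma> \<and> \<not> alt_interior x \<phi> \<epsilon> h d \<gamma> \<or>
         \<not> alt_left x \<phi> \<epsilon> h d \<gamma> \<and> \<not> alt_right x \<phi> \<epsilon> h d \<gamma> \<and> alt_interior x \<phi> \<epsilon> h d \<gamma>) \<and>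
        (cond_left x \<phi> \<epsilon> h d \<and> \<not> outward_ray x \<phi> \<epsilon> h d \<longrightarrow> \<gamma> = 0) \<and>
        (cond_right x \<phi> \<epsilon> h d \<and> \<not> inward_ray x \<phi> \<epsilon> h d \<longrightarrow> \<gamma> = 1) \<and>
        (\<not> cond_left x \<phi> \<epsilon> h d \<and> \<not> cond_right x \<phi> \<epsilon> h d \<longrightarrow> alt_interior x \<phi> \<epsilon> h d \<gamma>)"
    proof cases
      case left
      then have "argmin_set x \<phi> \<epsilon> h d = {0}"
        by (rule argmin_left[OF u v])
      with argmin left show ?thesis
        by (intro exI[of _ 0]) (auto simp: alts)
    next
      case right
      then have "argmin_set x \<phi> \<epsilon> h d = {1}"
        by (rule argmin_right[OF u v])
      with argmin right show ?thesis
        by (intro exI[of _ 1]) (auto simp: alts)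
    next
      case interior
      then obtain g where "argmin_set x \<phi> \<epsilon> h d = {g}" "alt_interior x \<phi> \<epsilon> h d g"
        using argmin_interior[OF u] by blast
      with interior show ?thesis
        by (intro exI[of _ g]) (auto simp: alts)
    qed
  next
    assume v: "\<phi> d = 0"
    show "cond_left x \<phi> \<epsilon> h d" "cond_right x \<phi> \<epsilon> h d"
      using u v by (simp_all add: cond_left_iff cond_right_iff)
    show "argmin_set x \<phi> \<epsilon> h d = {0..1}"
      by (auto simp: argmin_set_def is_arg_min_def eta_ext_eq phi_step v)
  qed
qed

end
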